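(* For $n\in\mathbb{Z}^+$ let $p_n$ denote the $n$th prime and let $S_n=\sum_{k=1}^n p_k$ be the sum of the first $n$ primes. Then the sequence $\left(\sqrt[n]{S_n}\right)_{n\geqslant 2}$ is strictly decreasing, and the sequence $\left(\sqrt[n]{S_n/n}\right)_{n\geqslant 1}$ is strictly decreasing.
   Context: $p_n$ denotes the $n$th prime ($p_1=2,p_2=3,\dots$), and $S_n=p_1+\cdots+p_n$. *)

theory Defs
  imports "HOL-Analysis.Analysis" "HOL-Computational_Algebra.Primes"
begin

text \<open>The n-th prime, 1-indexed: nth_prime 1 = 2, nth_prime 2 = 3, ...
  (enumerate lists an infinite set of naturals in increasing order, 0-indexed).\<close>
definition nth_prime :: "nat \<Rightarrow> nat" where
  "nth_prime n = enumerate {p::nat. prime p} (n - 1)"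

definition prime_sum :: "nat \<Rightarrow> nat" where
  "prime_sum n = (\<Sum>k=1..n. nth_prime k)"

end

theory Submission
  imports Defs
begin

text \<open>
  Put \<open>A = S\<^sub>n / n\<close> and \<open>q = p\<^sub>n\<^sub>+\<^sub>1\<close>. Since \<open>ln (1 + x) \<le> x\<close>, the second sequence decreases
  at \<open>n\<close> as soon as \<open>q / A < ln A + n ln (1 + 1 / n)\<close>, and this also gives the first sequence
  because \<open>(n + 1)\<^sup>n \<le> n\<^sup>n\<^sup>+\<^sup>1\<close> for \<open>n \<ge> 3\<close>. An upper bound for \<open>q\<close> comes from the central binomial
  coefficient: the primes below \<open>q\<close> are just \<open>p\<^sub>1, \<dots>, p\<^sub>n\<close>, so \<open>2\<^sup>q\<^sup>-\<^sup>2 \<le> q\<^sup>n\<close>. A lower bound for \<open>A\<close> comes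
  from the wheel modulo 30: only 8 residue classes contain primes above 5, hence
  \<open>p\<^sub>k\<^sub>+\<^sub>8 \<ge> p\<^sub>k + 30\<close>, which yields \<open>A \<ge> 1.7 n\<close> for \<open>n \<ge> 26\<close>. As \<open>1.7 ln 2 > 1 + 1/6\<close>, bounding
  \<open>ln q\<close> by its tangent at \<open>6 A\<close> turns the two bounds into the required one. The cases
  \<open>n < 26\<close> are computed.
\<close>

section \<open>Prime powers in binomial coefficients\<close>

text \<open>The hypothesis says \<open>1 / a = 1 / b - 1 / c\<close>, the recurrence of Leibniz' harmonic triangle.\<close>
lemma dvd_lcm_of_harmonic:
  fixes a b c :: int
  assumes "b * (a + c) = a * c"
  shows "a dvd lcm b c"
proof (cases "gcd b c = 0")
  case False
  \<comment> \<open>The hypothesis rearranges to \<open>b * c = a * (c - b)\<close>. Since the gcd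
    divides \<open>c - b\<close>, it cancels from \<open>gcd b c * lcm b c\<close>, leaving
    \<open>a * t\<close> up to sign.\<close>
  obtain t where t: "c - b = gcd b c * t"
    by (meson dvdE dvd_diff gcd_dvd1 gcd_dvd2)
  have "gcd b c * \<bar>lcm b c\<bar> = \<bar>b * c\<bar>"
    by (metis abs_mult gcd_mult_lcm abs_lcm_int normalize_int_def)
  also have "b * c = a * (c - b)"
    using assms by (simp add: algebra_simps)
  also have "\<dots> = gcd b c * (a * t)"
    by (simp only: t mult.left_commute)
  finally have "gcd b c * \<bar>lcm b c\<bar> = gcd b c * \<bar>a * t\<bar>"
    by (simp add: abs_mult)
  then show ?thesis using False
    by (metis abs_dvd_iff dvd_abs_iff dvd_triv_left mult_left_cancel)
qed simp

text \<open>The numbers \<open>Suc (k + d) * (k + d choose k)\<close> are the reciprocals of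
  Leibniz' triangle, and each divides the lcm of an entry one row up and its neighbour in the same
  row. A prime power dividing an lcm divides one of the two arguments, so it can be pushed to the
  border \<open>d = 0\<close>, where the entry is \<open>Suc k\<close>.\<close>

lemma prime_power_dvd_binomial_le:
  fixes p :: nat
  assumes "prime p" "p ^ i dvd Suc (k + d) * (k + d choose k)"
  shows "p ^ i \<le> Suc (k + d)"
  using assms(2)
proof (induction d arbitrary: k)
  case 0
  then show ?case by (auto intro: dvd_imp_le)
next
  case (Suc d)
  define N where "N = Suc (k + d)"
  define A where "A = Suc N * (N choose k)"
  define B where "B = N * (k + d choose k)"
  define C where "C = Suc N * (N choose Suc k)"
  have B: "B = Suc k * (N choose Suc k)"
    unfolding B_def N_def using Suc_times_binomial_eq[of "k+d" k] by (simp only: mult.commute)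
  have "A + C = Suc N * (Suc N choose Suc k)"
    by (simp add: A_def C_def algebra_simps)
  moreover have "Suc N * (N choose k) = (Suc N choose Suc k) * Suc k"
    by (rule Suc_times_binomial_eq)
  ultimately have "B * (A + C) = A * C"
    unfolding B by (simp only: A_def C_def ac_simps)
  then have "int B * (int A + int C) = int A * int C"
    by (metis of_nat_add of_nat_mult)
  then have "int A dvd lcm (int B) (int C)"
    by (rule dvd_lcm_of_harmonic)
  then have "A dvd lcm B C"
    by (metis lcm_int_int_eq int_dvd_int_iff)
  moreover have "p ^ i dvd A"
    using Suc.prems by (simp add: A_def N_def)
  ultimately have "p ^ i dvd lcm B C" by (rule dvd_trans[rotated])
  moreover have "B \<noteq> 0" "C \<noteq> 0"
    by (auto simp: B_def C_def N_def)
  moreover have "p ^ i dvd x \<longleftrightarrow> i \<le> multiplicity p x" if "x \<noteq> 0" for x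
    using that assms(1) by (intro power_dvd_iff_le_multiplicity) auto
  ultimately have "p ^ i dvd B \<or> p ^ i dvd C"
    using assms(1) by (simp add: multiplicity_lcm lcm_eq_0_iff le_max_iff_disj)
  then show ?case
  proof
    assume "p ^ i dvd B"
    then show ?thesis using Suc.IH[of k] by (simp add: B_def N_def)
  next
    assume "p ^ i dvd C"
    then show ?thesis using Suc.IH[of "Suc k"] by (simp add: C_def N_def)
  qed
qed

text \<open>By absorption \<open>m * (n choose m)\<close> is a triangle entry of row
  \<open>n\<close>, so each prime power in its factorization is at most \<open>n\<close>; there is
  at most one such factor for each prime up to \<open>n\<close>.\<close>

lemma binomial_le_power_prime_count:
  assumes "0 < m" "m \<le> n"
  shows "m * (n choose m) \<le> n ^ card {p. prime p \<and> p \<le> n}"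
proof -
  define x where "x = m * (n choose m)"
  obtain k d where kd: "m = Suc k" "n = Suc (k + d)"
    using assms by (metis add_Suc gr0_implies_Suc le_Suc_ex)
  have x: "x = Suc (k + d) * (k + d choose k)"
    by (simp only: x_def kd Suc_times_binomial_eq mult.commute)
  have "x \<noteq> 0" using assms by (simp add: x_def)
  have le: "p ^ multiplicity p x \<le> n" if "prime p" for p
    using prime_power_dvd_binomial_le[OF that] multiplicity_dvd[of p x] by (simp add: x kd)
  have sub: "prime_factors x \<subseteq> {p. prime p \<and> p \<le> n}"
  proof
    fix p assume "p \<in> prime_factors x"
    then have p: "prime p" "multiplicity p x > 0"
      by (auto simp: prime_factors_multiplicity)
    then have "p ^ 1 \<le> p ^ multiplicity p x"
      by (intro power_increasing) (auto dest: prime_gt_0_nat)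
    with le[OF p(1)] p(1) show "p \<in> {p. prime p \<and> p \<le> n}" by auto
  qed
  have "x = (\<Prod>p \<in> prime_factors x. p ^ multiplicity p x)"
    using prod_prime_factors[OF \<open>x \<noteq> 0\<close>] by simp
  also have "\<dots> \<le> n ^ card {p. prime p \<and> p \<le> n}"
    using le sub assms by (intro prod_le_power) (auto intro!: card_mono)
  finally show ?thesis by (simp add: x_def)
qed

section \<open>Enumeration of the primes\<close>

lemma nth_prime_Suc: "nth_prime (Suc n) = enumerate {p. prime p} n"
  by (simp add: nth_prime_def)

lemma prime_nth_prime: "prime (nth_prime n)"
  using enumerate_in_set[OF primes_infinite] by (simp add: nth_prime_def)

lemma nth_prime_Suc_less_iff [simp]: "nth_prime (Suc i) < nth_prime (Suc j) \<longleftrightarrow> i < j"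
  by (simp add: nth_prime_Suc primes_infinite)

lemma nth_prime_Suc_le_iff [simp]: "nth_prime (Suc i) \<le> nth_prime (Suc j) \<longleftrightarrow> i \<le> j"
  by (simp add: nth_prime_Suc primes_infinite)

lemma primes_below_nth_prime: "{p. prime p \<and> p < nth_prime (Suc n)} = (\<lambda>i. nth_prime (Suc i)) ` {..<n}"
proof (intro equalityI subsetI)
  fix p assume p: "p \<in> {p. prime p \<and> p < nth_prime (Suc n)}"
  then obtain i where "p = nth_prime (Suc i)"
    using enumerate_Ex[OF primes_infinite, of p] by (auto simp: nth_prime_Suc)
  with p show "p \<in> (\<lambda>i. nth_prime (Suc i)) ` {..<n}" by auto
qed (auto simp: prime_nth_prime)

lemma card_primes_below_nth_prime: "card {p. prime p \<and> p < nth_prime (Suc n)} = n"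
proof -
  have "inj_on (\<lambda>i. nth_prime (Suc i)) {..<n}"
    by (metis (mono_tags, lifting) inj_onI linorder_neq_iff nth_prime_Suc_less_iff)
  then show ?thesis by (simp add: primes_below_nth_prime card_image)
qed

lemma nth_prime_eqI:
  assumes "prime p" "card {q. prime q \<and> q < p} = n"
  shows "nth_prime (Suc n) = p"
proof -
  obtain i where i: "p = nth_prime (Suc i)"
    using enumerate_Ex[OF primes_infinite, of p] assms(1) by (auto simp: nth_prime_Suc)
  with assms(2) show ?thesis using card_primes_below_nth_prime by metis
qed

lemma nth_prime_filter:
  assumes "filter prime [0..<N] = ps" "i < length ps"
  shows "nth_prime (Suc i) = ps ! i"
proof (rule nth_prime_eqI)
  have mem: "ps ! i \<in> set (filter prime [0..<N])" using assms by simp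
  then show "prime (ps ! i)" by simp
  have sorted: "sorted ps" "distinct ps"
    using assms(1) by (auto intro: sorted_wrt_filter simp flip: assms(1))
  have "{q. prime q \<and> q < ps ! i} = {q \<in> set ps. q < ps ! i}"
    using mem by (auto simp flip: assms(1))
  also have "\<dots> = (\<lambda>j. ps ! j) ` {..<i}"
  proof (intro equalityI subsetI)
    fix q assume "q \<in> {q \<in> set ps. q < ps ! i}"
    then obtain j where "j < length ps" "q = ps ! j" "ps ! j < ps ! i"
      by (auto simp: in_set_conv_nth)
    then show "q \<in> (\<lambda>j. ps ! j) ` {..<i}"
      using sorted_nth_mono[OF sorted(1)] by (metis imageI lessThan_iff not_le)
  next
    fix q assume "q \<in> (\<lambda>j. ps ! j) ` {..<i}"
    then show "q \<in> {q \<in> set ps. q < ps ! i}"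
      using assms(2) sorted sorted_nth_mono[OF sorted(1)] nth_eq_iff_index_eq[OF sorted(2)]
      by (fastforce simp: order_less_le)
  qed
  also have "card \<dots> = i"
    using sorted(2) assms(2) by (subst card_image) (auto simp: inj_on_def nth_eq_iff_index_eq)
  finally show "card {q. prime q \<and> q < ps ! i} = i" .
qed

text \<open>One table for all numerical cases: sums are evaluated up to
  \<open>prime_sum 26\<close>.\<close>

lemma primes_below_104:
  "filter prime [0..<104] = [2, 3, 5, 7, 11, 13, 17, 19, 23, 29, 31, 37, 41, 43, 47, 53, 59, 61,
     67, 71, 73, 79, 83, 89, 97, 101, 103::nat]"
  by code_simp

section \<open>Growth of the primes and of their sums\<close>

lemma two_power_le_nth_prime_power:
  assumes "n \<ge> 1"
  shows "2 ^ (nth_prime (Suc n) - 2) \<le> nth_prime (Suc n) ^ n"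
proof -
  define q where "q = nth_prime (Suc n)"
  have q: "prime q" by (simp add: q_def prime_nth_prime)
  have "nth_prime (Suc 0) < q" using assms by (simp add: q_def)
  then have "q > 2"
    using prime_ge_2_nat[OF prime_nth_prime[of "Suc 0"]] by linarith
  with q have "odd q" using prime_odd_nat by auto
  then obtain m where m: "q = 2 * m + 1" by (auto elim: oddE)
  with \<open>q > 2\<close> have "m > 0" by simp
  have "real (4 ^ m) \<le> real (2 * (m * (2 * m choose m)))"
    using central_binomial_lower_bound[OF \<open>m > 0\<close>] \<open>m > 0\<close>
    by (simp add: field_simps)
  then have "4 ^ m \<le> 2 * (m * (2 * m choose m))"
    by (simp only: of_nat_le_iff)
  also have "m * (2 * m choose m) \<le> (2 * m) ^ card {p. prime p \<and> p \<le> 2 * m}"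
    using \<open>m > 0\<close> by (intro binomial_le_power_prime_count) auto
  also have "{p. prime p \<and> p \<le> 2 * m} = {p. prime p \<and> p < q}"
    by (auto simp: m)
  also have "card \<dots> = n" unfolding q_def by (rule card_primes_below_nth_prime)
  finally have "4 ^ m \<le> 2 * (2 * m) ^ n" by simp
  moreover have "(2 * m) ^ n \<le> q ^ n" by (intro power_mono) (auto simp: m)
  \<comment> \<open>Because \<open>2 * m = q - 1\<close>, a factor 2 splits off and cancels the one
    from the central binomial bound.\<close>
  moreover have "(4::nat) ^ m = 2 * 2 ^ (q - 2)"
  proof -
    have "2 * m = Suc (q - 2)" using \<open>q > 2\<close> m by simp
    then have "(2::nat) ^ (2 * m) = 2 * 2 ^ (q - 2)" by (simp only: power_Suc)
    then show ?thesis by (simp add: power_mult)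
  qed
  ultimately show ?thesis by (simp add: q_def)
qed

text \<open>Pigeonhole: from \<open>n = 4\<close> on the primes exceed 5 and are coprime to 30. Nine
  of them within a distance below 30 would have distinct residues in only 8 classes.\<close>

lemma nth_prime_add_8:
  assumes "n \<ge> 4"
  shows "nth_prime n + 30 \<le> nth_prime (n + 8)"
proof (rule ccontr)
  assume less: "\<not> nth_prime n + 30 \<le> nth_prime (n + 8)"
  let ?R = "{1, 7, 11, 13, 17, 19, 23, 29} :: nat set"
  let ?f = "\<lambda>i. nth_prime (n + i) mod 30"
  obtain k where k: "n = Suc k" using assms by (cases n) auto
  have "?f ` {..8} \<subseteq> ?R"
  proof
    fix r assume "r \<in> ?f ` {..8}"
    then obtain i where i: "r = nth_prime (n + i) mod 30" by auto
    define q where "q = nth_prime (n + i)"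
    have q: "prime q" by (simp add: q_def prime_nth_prime)
    have "nth_prime (Suc 2) < nth_prime (Suc (k + i))"
      using assms k by (simp only: nth_prime_Suc_less_iff)
    moreover have "nth_prime (Suc 2) = 5"
      using nth_prime_filter[OF primes_below_104, of 2] by simp
    ultimately have "q > 5" by (simp add: q_def k)
    have nd: "\<not> d dvd q" if "1 < d" "d \<le> 5" for d
      using q \<open>q > 5\<close> that by (auto simp: prime_nat_iff)
    have "\<not> 2 dvd q mod 30" "\<not> 3 dvd q mod 30" "\<not> 5 dvd q mod 30"
      using nd[of 2] nd[of 3] nd[of 5] by (simp_all add: dvd_mod_iff)
    moreover have "\<forall>r \<in> set [0..<30]. 2 dvd r \<or> 3 dvd r \<or> 5 dvd r \<or> r \<in> ?R"
      by code_simp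
    moreover have "q mod 30 \<in> set [0..<30]" by simp
    ultimately have "q mod 30 \<in> ?R" by blast
    then show "r \<in> ?R" by (simp add: i q_def)
  qed
  moreover have "inj_on ?f {..8}"
  proof (rule linorder_inj_onI)
    fix i j :: nat assume ij: "i < j" "i \<in> {..8}" "j \<in> {..8}"
    let ?a = "nth_prime (n + i)" and ?b = "nth_prime (n + j)"
    have lt: "?a < ?b" and "nth_prime n \<le> ?a" "?b \<le> nth_prime (n + 8)"
      using ij nth_prime_Suc_le_iff[of "k + j" "k + 8"] by (simp_all add: k)
    then have "?b - ?a < 30" using less by linarith
    with lt have "\<not> 30 dvd ?b - ?a" by (auto dest: dvd_imp_le)
    then show "?a mod 30 \<noteq> ?b mod 30"
      using mod_eq_dvd_iff_nat[of ?a ?b 30] lt by auto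
  qed auto
  ultimately have "card {..8::nat} \<le> card ?R"
    by (intro card_inj_on_le) auto
  then show False by simp
qed

lemma prime_sum_Suc: "prime_sum (Suc n) = prime_sum n + nth_prime (Suc n)"
  by (simp add: prime_sum_def)

lemma prime_sum_filter:
  assumes "filter prime [0..<N] = ps" "n \<le> length ps"
  shows "prime_sum n = sum_list (take n ps)"
  using assms(2)
  by (induction n)
     (simp_all add: prime_sum_Suc nth_prime_filter[OF assms(1)] take_Suc_conv_app_nth prime_sum_def)

text \<open>Shaped for summation: \<open>17 * (n + 1)^2 - 17 * n^2 = 34 * (n + 1) - 17\<close>.
  Eight steps cost 272 on the left and gain at least 300 on the right, so eight consecutive base
  cases suffice.\<close>

lemma nth_prime_ge_linear:
  assumes "n \<ge> 16"
  shows "34 * n \<le> 10 * nth_prime n + 17"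
  using assms
proof (induction n rule: less_induct)
  case (less n)
  show ?case
  proof (cases "n < 24")
    case True
    then have "n \<in> {16, 17, 18, 19, 20, 21, 22, 23}" using less.prems by auto
    then show ?thesis
      using nth_prime_filter[OF primes_below_104, of "n - 1"] by (auto simp: nth_Cons_numeral)
  next
    case False
    then obtain k where "n = k + 8" "k \<ge> 16"
      using that[of "n - 8"] by simp
    then show ?thesis using less.IH[of k] nth_prime_add_8[of k] by simp
  qed
qed

lemma prime_sum_ge_quadratic:
  assumes "n \<ge> 26"
  shows "17 * n\<^sup>2 \<le> 10 * prime_sum n"
  using assms
proof (induction n rule: dec_induct)
  \<comment> \<open>This fixes the threshold 26: here 11492 <= 11610, whereas at 25 the inequality
    fails, 10625 > 10600.\<close>
  case base
  then show ?case by (simp add: prime_sum_filter[OF primes_below_104])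
next
  case (step n)
  then show ?case using nth_prime_ge_linear[of "Suc n"]
    by (simp add: prime_sum_Suc power2_eq_square)
qed

section \<open>Small cases and logarithmic estimates\<close>

lemma ratio_ineq_small:
  assumes "1 \<le> n" "n < 26"
  shows "prime_sum (Suc n) ^ n * n ^ Suc n < prime_sum n ^ Suc n * Suc n ^ n"
proof -
  have "n = 1 \<or> n \<in> set [2..<26]" using assms by (auto simp del: upt_rec_numeral)
  then show ?thesis
    by (auto simp: prime_sum_filter[OF primes_below_104])
qed

lemma ln_le_tangent:
  fixes x t :: real
  assumes "x > 0" "t > 0"
  shows "ln x \<le> x / t - 1 + ln t"
  using ln_le_minus_one[of "x / t"] assms by (simp add: ln_div)

lemma ln_Suc_inverse_ge: "real n * ln (1 + 1 / real n) \<ge> real n / (real n + 1)" if "n \<ge> 1"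
proof -
  have "ln (real n / (real n + 1)) \<le> real n / (real n + 1) - 1"
    using that by (intro ln_le_minus_one) auto
  moreover have "ln (1 + 1 / real n) = - ln (real n / (real n + 1))"
    using that by (simp add: ln_div[symmetric] field_simps flip: ln_inverse)
  ultimately have "1 / (real n + 1) \<le> ln (1 + 1 / real n)"
    by (simp add: field_simps)
  from mult_left_mono[OF this, of "real n"] show ?thesis by simp
qed

lemma ln_2_ge: "ln 2 \<ge> (0.689 :: real)"
proof -
  \<comment> \<open>\<open>56 / 81 = 2 * (1/3 + (1/3)^3 / 3)\<close>, two terms of the artanh series
    for \<open>ln 2\<close>.\<close>
  have "56 / 81 \<le> ln (2 :: real)"
    using ln_approx_bounds[of 2 2, simplified, simplified eval_nat_numeral, simplified] by simp
  then show ?thesis by simp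
qed

lemma ln_6_le: "ln 6 \<le> (1.84 :: real)"
proof -
  have "ln (6::real) = 3 * ln 2 + ln (3/4)"
    using ln_mult_pos[of "8::real" "3/4"] ln_realpow[of 2 3] by simp
  with ln2_le_25_over_36 ln_le_minus_one[of "3/4::real"] show ?thesis by simp
qed

lemma nth_prime_less_average:
  fixes n :: nat
  defines "A \<equiv> prime_sum n / n"
  assumes n: "n \<ge> 26"
  shows "nth_prime (Suc n) / A < ln A + n / (n + 1)"
proof -
  define q where "q = nth_prime (Suc n)"
  have "q \<ge> 2" unfolding q_def by (intro prime_ge_2_nat prime_nth_prime)
  have "real (17 * n\<^sup>2) \<le> real (10 * prime_sum n)"
    using prime_sum_ge_quadratic[OF n] by (simp only: of_nat_le_iff)
  then have A: "1.7 * n \<le> A"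
    using n by (simp add: A_def field_simps power2_eq_square)
  with n have A44: "A \<ge> 44.2" by simp
  have "real (2 ^ (q - 2)) \<le> real (q ^ n)"
    using two_power_le_nth_prime_power[of n] n unfolding q_def by (simp only: of_nat_le_iff)
  then have "ln (2 ^ (q - 2)) \<le> ln (real q ^ n)"
    using \<open>q \<ge> 2\<close> by (subst ln_le_cancel_iff) auto
  then have "(q - 2) * ln 2 \<le> n * ln q"
    using \<open>q \<ge> 2\<close> by (simp add: ln_realpow of_nat_diff)
  also have "n * ln q \<le> A / 1.7 * ln q"
    using A \<open>q \<ge> 2\<close> by (intro mult_right_mono) auto
  also have "\<dots> \<le> A / 1.7 * (q / (6 * A) - 1 + ln (6 * A))"
    using A44 \<open>q \<ge> 2\<close> by (intro mult_left_mono ln_le_tangent) auto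
  also have "\<dots> = (q / 6 + A * (ln A + ln 6 - 1)) / 1.7"
    using A44 by (simp add: field_simps ln_mult_pos)
  finally have "1.7 * (q - 2) * ln 2 \<le> q / 6 + A * (ln A + ln 6 - 1)"
    by simp
  moreover have "1.7 * (q - 2) * 0.689 \<le> 1.7 * (q - 2) * ln 2"
    using ln_2_ge \<open>q \<ge> 2\<close> by (intro mult_left_mono) auto
  \<comment> \<open>\<open>1.7 * 0.689 = 1.1713\<close> exceeds \<open>1 + 1/6\<close>, so
    \<open>q\<close> keeps a coefficient above 1; 2.4 rounds up \<open>2 * 1.1713\<close>.\<close>
  ultimately have "q \<le> A * (ln A + ln 6 - 1) + 2.4"
    using \<open>q \<ge> 2\<close> by (simp add: of_nat_diff)
  also have "\<dots> \<le> A * (ln A + 0.84) + 2.4"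
    using ln_6_le A44 by (intro add_right_mono mult_left_mono) auto
  \<comment> \<open>\<open>26 / 27\<close> is \<open>n / (n + 1)\<close> at \<open>n = 26\<close>;
    its excess over 0.84, multiplied by \<open>A >= 44.2\<close>, absorbs 2.4.\<close>
  also have "\<dots> < A * (ln A + 26 / 27)"
    using A44 by (simp add: algebra_simps)
  also have "26 / 27 \<le> n / (n + 1)"
    using n by (simp add: field_simps)
  finally show ?thesis
    using A44 by (simp add: q_def field_simps)
qed

section \<open>Comparison of consecutive roots\<close>

lemma root_less_rootI:
  fixes x y :: real
  assumes "n \<ge> 1" "x \<ge> 0" "y \<ge> 0" "x ^ n < y ^ Suc n"
  shows "root (Suc n) x < root n y"
proof (rule ccontr)
  assume "\<not> root (Suc n) x < root n y"
  then have "root n y ^ (n * Suc n) \<le> root (Suc n) x ^ (n * Suc n)"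
    using assms by (intro power_mono) auto
  then have "(root n y ^ n) ^ Suc n \<le> (root (Suc n) x ^ Suc n) ^ n"
    by (metis power_mult mult.commute)
  with assms show False by (simp del: power_Suc)
qed

lemma ratio_ineq:
  assumes n: "n \<ge> 1"
  shows "(real (prime_sum (Suc n)) / real (Suc n)) ^ n < (real (prime_sum n) / real n) ^ Suc n"
proof (cases "n < 26")
  case True
  have "real (prime_sum (Suc n) ^ n * n ^ Suc n) < real (prime_sum n ^ Suc n * Suc n ^ n)"
    using ratio_ineq_small[OF n True] by (simp only: of_nat_less_iff)
  then show ?thesis using n by (simp add: power_divide divide_simps)
next
  case False
  define S q where "S = real (prime_sum n)" and "q = real (nth_prime (Suc n))"
  define A where "A = S / n"
  have "q > 0" using prime_gt_0_nat[OF prime_nth_prime] by (simp add: q_def)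
  have "17 * n\<^sup>2 \<le> 10 * prime_sum n" using False prime_sum_ge_quadratic by simp
  then have "S > 0" using n by (cases "prime_sum n = 0") (auto simp: S_def)
  then have "A > 0" using n by (simp add: A_def)
  \<comment> \<open>This turns the goal, after multiplying by \<open>(1 + 1 / n) ^ n\<close>, into a
    comparison of products whose logarithms are estimated next.\<close>
  have eq: "real (prime_sum (Suc n)) / Suc n * (1 + 1 / n) = A * (1 + q / S)"
  proof -
    have "1 + 1 / real n = Suc n / n" using n by (simp add: field_simps)
    moreover have "real (prime_sum (Suc n)) = S * (1 + q / S)"
      using \<open>S > 0\<close> by (simp add: S_def q_def prime_sum_Suc distrib_left)
    ultimately show ?thesis by (simp add: A_def del: of_nat_Suc)
  qed
  have "n * ln (1 + q / S) \<le> n * (q / S)"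
    using \<open>q > 0\<close> \<open>S > 0\<close> by (intro mult_left_mono ln_add_one_self_le_self) auto
  also have "\<dots> = q / A" by (simp add: A_def)
  also have "\<dots> < ln A + n / (n + 1)"
    using nth_prime_less_average[of n] False by (simp add: A_def S_def q_def)
  also have "\<dots> \<le> ln A + n * ln (1 + 1 / n)"
    using ln_Suc_inverse_ge[OF n] by (simp add: add.commute)
  finally have "n * (ln A + ln (1 + q / S)) < Suc n * ln A + n * ln (1 + 1 / n)"
    by (simp add: algebra_simps)
  also have "ln A + ln (1 + q / S) = ln (A * (1 + q / S))"
    using \<open>A > 0\<close> \<open>q > 0\<close> \<open>S > 0\<close> by (intro ln_mult_pos[symmetric] add_pos_pos) auto
  finally have "ln ((A * (1 + q / S)) ^ n) < ln (A ^ Suc n * (1 + 1 / n) ^ n)"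
    using \<open>A > 0\<close> \<open>q > 0\<close> \<open>S > 0\<close> n
    by (simp add: ln_mult_pos ln_realpow add_pos_pos del: power_Suc)
  then have "(A * (1 + q / S)) ^ n < A ^ Suc n * (1 + 1 / n) ^ n"
    using \<open>A > 0\<close> \<open>q > 0\<close> \<open>S > 0\<close> n
    by (subst (asm) ln_less_cancel_iff) (auto intro!: mult_pos_pos zero_less_power add_pos_pos)
  then have "(real (prime_sum (Suc n)) / Suc n) ^ n * (1 + 1 / n) ^ n < A ^ Suc n * (1 + 1 / n) ^ n"
    by (simp only: eq[symmetric] power_mult_distrib)
  then show ?thesis by (simp add: A_def S_def mult_less_cancel_right del: power_Suc)
qed

text \<open>Divided by \<open>n ^ n\<close> this is \<open>(1 + 1 / n) ^ n <= n\<close>, which holds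
  because the left side is at most e, hence at most 3.\<close>

lemma Suc_power_le:
  assumes "n \<ge> 3"
  shows "real (Suc n) ^ n \<le> real n ^ Suc n"
proof -
  have "(1 + 1 / real n) ^ n \<le> exp (1 / real n) ^ n"
    by (intro power_mono exp_ge_add_one_self) auto
  also have "\<dots> = exp 1" using assms by (simp flip: exp_of_nat_mult)
  also have "\<dots> \<le> n" using exp_le assms by simp
  finally have "(1 + 1 / real n) ^ n * real n ^ n \<le> n * real n ^ n"
    by (intro mult_right_mono) auto
  moreover have "(1 + 1 / real n) * real n = real (Suc n)"
    using assms by (simp add: field_simps)
  ultimately show ?thesis by (simp only: power_mult_distrib[symmetric] power_Suc)
qed

theorem theorem2p1:
  shows "(\<forall>n\<ge>2. root (Suc n) (real (prime_sum (Suc n))) < root n (real (prime_sum n)))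
       \<and> (\<forall>n\<ge>1. root (Suc n) (real (prime_sum (Suc n)) / real (Suc n))
                 < root n (real (prime_sum n) / real n))"
proof (intro conjI allI impI)
  fix n :: nat
  assume "n \<ge> 1"
  then show "root (Suc n) (real (prime_sum (Suc n)) / real (Suc n)) < root n (real (prime_sum n) / real n)"
    by (intro root_less_rootI ratio_ineq) auto
next
  fix n :: nat
  assume n: "n \<ge> 2"
  have "real (prime_sum (Suc n)) ^ n < real (prime_sum n) ^ Suc n"
  \<comment> \<open>\<open>Suc_power_le\<close> fails at 2, since 9 > 8; there the claim is
    \<open>10^2 < 5^3\<close>.\<close>
  proof (cases "n = 2")
    case True
    then show ?thesis by (simp add: prime_sum_filter[OF primes_below_104])
  next
    case False
    then have "n \<ge> 3" using n by simp
    have "real (prime_sum (Suc n)) ^ n = (real (prime_sum (Suc n)) / Suc n) ^ n * real (Suc n) ^ n"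
      by (simp add: power_divide)
    also have "\<dots> < (real (prime_sum n) / n) ^ Suc n * real (Suc n) ^ n"
      using n by (intro mult_strict_right_mono ratio_ineq) auto
    also have "\<dots> \<le> (real (prime_sum n) / n) ^ Suc n * real n ^ Suc n"
      using \<open>n \<ge> 3\<close> by (intro mult_left_mono Suc_power_le) auto
    also have "\<dots> = real (prime_sum n) ^ Suc n"
      using n by (simp add: power_divide)
    finally show ?thesis .
  qed
  then show "root (Suc n) (real (prime_sum (Suc n))) < root n (real (prime_sum n))"
    using n by (intro root_less_rootI) auto
qed

end
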